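(* Every cobipartite $k$-tree is a linear $k$-tree.
   Context: A graph is cobipartite if its vertex set can be partitioned into two cliques. For an integer $k\ge1$, a $k$-tree is a graph constructed by starting with a $(k+1)$-clique and repeating (zero or more times) the step: choose $k$ vertices inducing a clique and add a new vertex adjacent to exactly those $k$ vertices. A linear $k$-tree is a $k$-tree that either is a $(k+1)$-clique or has exactly two vertices of degree $k$. *)

theory Defs
  imports "Graph_Theory.Graph_Theory"
begin

text \<open>
  Finite simple graphs are the symmetric loop-free digraphs of the locale \<^locale>\<open>pair_graph\<close>:
  an undirected edge is a pair of opposite arcs, and the degree of a vertex \<open>v\<close> is
  \<open>out_degree G v\<close>.
\<close>

definition clique :: "'a pair_pre_digraph \<Rightarrow> 'a set \<Rightarrow> bool" where
  "clique G S \<longleftrightarrow> S \<subseteq> pverts G \<and> (\<forall>u\<in>S. \<forall>v\<in>S. u \<noteq> v \<longrightarrow> (u, v) \<in> parcs G)"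

text \<open>A part of the partition may be empty, so every complete graph is cobipartite.\<close>

definition cobipartite :: "'a pair_pre_digraph \<Rightarrow> bool" where
  "cobipartite G \<longleftrightarrow> pair_graph G \<and>
    (\<exists>A B. A \<union> B = pverts G \<and> A \<inter> B = {} \<and> clique G A \<and> clique G B)"

definition add_vertex :: "'a pair_pre_digraph \<Rightarrow> 'a \<Rightarrow> 'a set \<Rightarrow> 'a pair_pre_digraph" where
  "add_vertex G v S =
    \<lparr> pverts = insert v (pverts G), parcs = parcs G \<union> {v} \<times> S \<union> S \<times> {v} \<rparr>"

text \<open>Meaningful for \<open>k \<ge> 1\<close>.\<close>

inductive k_tree :: "nat \<Rightarrow> 'a pair_pre_digraph \<Rightarrow> bool" for k where
  base: "K\<^bsub>k + 1\<^esub> (with_proj G) \<Longrightarrow> k_tree k G"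
| step: "k_tree k G \<Longrightarrow> clique G S \<Longrightarrow> card S = k \<Longrightarrow> v \<notin> pverts G \<Longrightarrow>
    k_tree k (add_vertex G v S)"

definition linear_k_tree :: "nat \<Rightarrow> 'a pair_pre_digraph \<Rightarrow> bool" where
  "linear_k_tree k G \<longleftrightarrow> k_tree k G \<and>
    (K\<^bsub>k + 1\<^esub> (with_proj G) \<or> card {v \<in> pverts G. out_degree (with_proj G) v = k} = 2)"

lemma pair_graph_add_vertex:
  assumes "pair_graph G" "clique G S" "v \<notin> pverts G"
  shows "pair_graph (add_vertex G v S)"
proof -
  interpret pair_graph G by fact
  have S: "S \<subseteq> pverts G" "finite S"
    using assms(2) pair_finite_verts by (auto simp: clique_def intro: finite_subset)
  have sym: "sym (parcs G)"
    using pair_sym_arcs by (simp add: symmetric_def)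
  show ?thesis
  proof
    show "symmetric (with_proj (add_vertex G v S))"
      using sym by (auto simp: symmetric_def add_vertex_def sym_def)
  qed (use S assms(3) in \<open>auto simp: add_vertex_def pair_finite_verts pair_finite_arcs
        dest: in_arcsD1 in_arcsD2 pair_no_loops\<close>)
qed

lemma k_tree_pair_graph: "k_tree k G \<Longrightarrow> pair_graph G"
  by (induction rule: k_tree.induct)
    (auto intro: pair_graphI_complete pair_graph_add_vertex)

end

(* In a k-tree on more than k + 1 vertices the vertices of degree k are pairwise nonadjacent and
   there are at least two of them. Both facts follow by induction on the construction: the new
   vertex has degree k, its k neighbours leave the set of degree-k vertices, and the clique of
   these neighbours meets an independent set in at most one vertex (respectively misses just one
   vertex of a (k+1)-clique). A partition into two cliques then allows at most two such
   vertices. *)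
theory Submission
  imports Defs
begin

definition verts_of_degree :: "nat \<Rightarrow> 'a pair_pre_digraph \<Rightarrow> 'a set" where
  "verts_of_degree k G = {v \<in> pverts G. out_degree (with_proj G) v = k}"

text \<open>The case \<open>u = v\<close> is included, unlike in \<open>clique\<close>; it only
  rules out loops, which a \<open>pair_graph\<close> does not have.\<close>

definition indep :: "'a pair_pre_digraph \<Rightarrow> 'a set \<Rightarrow> bool" where
  "indep G S \<longleftrightarrow> (\<forall>u\<in>S. \<forall>v\<in>S. (u, v) \<notin> parcs G)"

lemma card_le_1I: "(\<And>x y. x \<in> A \<Longrightarrow> y \<in> A \<Longrightarrow> x = y) \<Longrightarrow> card A \<le> 1"
  by (metis One_nat_def card.infinite card_le_Suc0_iff_eq zero_le)

text \<open>Two distinct common vertices would be both adjacent and nonadjacent.\<close>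

lemma card_clique_Int_indep:
  assumes "clique G S" "indep G I"
  shows "card (S \<inter> I) \<le> 1"
  using assms by (intro card_le_1I) (unfold clique_def indep_def, blast)

lemma out_degree_eq_card_nbrs: "out_degree (with_proj G) u = card {w. (u, w) \<in> parcs G}"
proof -
  have "out_arcs (with_proj G) u = Pair u ` {w. (u, w) \<in> parcs G}"
    by (auto simp: out_arcs_def)
  then show ?thesis
    by (simp add: out_degree_def card_image inj_on_def)
qed

lemma out_degree_complete:
  assumes "K\<^bsub>n\<^esub> (with_proj G)" "u \<in> pverts G"
  shows "out_degree (with_proj G) u = n - 1"
proof -
  interpret pair_graph G using assms(1) by (rule pair_graphI_complete)
  have "{w. (u, w) \<in> parcs G} = pverts G - {u}"
    using assms by (auto simp: complete_digraph_def arcs_ends_conv)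
  moreover have "card (pverts G) = n"
    using assms(1) by (simp add: complete_digraph_def)
  ultimately show ?thesis
    using assms(2) pair_finite_verts by (simp add: out_degree_eq_card_nbrs)
qed

lemma out_degree_add_vertex:
  assumes "pair_graph G" "S \<subseteq> pverts G" "v \<notin> pverts G"
  shows "out_degree (with_proj (add_vertex G v S)) u =
    (if u = v then card S
     else if u \<in> S then Suc (out_degree (with_proj G) u)
     else out_degree (with_proj G) u)"
proof -
  interpret pair_graph G by fact
  have new: "(v, w) \<notin> parcs G" "(w, v) \<notin> parcs G" for w
    using assms(3) by (auto dest: in_arcsD1 in_arcsD2)
  have "v \<notin> S" using assms by auto
  \<comment> \<open>Finiteness makes inserting \<open>v\<close> into the neighbourhood raise its
    cardinality by exactly one.\<close>
  have "finite {w. (u, w) \<in> parcs G}"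
    by (rule finite_subset[OF _ pair_finite_verts]) (auto dest: in_arcsD2)
  moreover have "{w. (u, w) \<in> parcs (add_vertex G v S)} =
    (if u = v then S
     else if u \<in> S then insert v {w. (u, w) \<in> parcs G}
     else {w. (u, w) \<in> parcs G})"
    using new \<open>v \<notin> S\<close> by (auto simp: add_vertex_def)
  ultimately show ?thesis
    using new by (simp add: out_degree_eq_card_nbrs)
qed

text \<open>A vertex starts with degree at least \<open>k\<close>, and later steps only add
  arcs.\<close>

lemma k_tree_out_degree_ge:
  assumes "k_tree k G" "u \<in> pverts G"
  shows "k \<le> out_degree (with_proj G) u"
  using assms
proof (induction arbitrary: u rule: k_tree.induct)
  case (base G)
  then show ?case by (simp add: out_degree_complete)
next
  case (step G S v)
  have "u = v \<or> u \<in> pverts G"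
    using step.prems by (auto simp: add_vertex_def)
  moreover have "S \<subseteq> pverts G"
    using step.hyps by (simp add: clique_def)
  ultimately show ?case
    using step k_tree_pair_graph[OF step.hyps(1)]
    by (auto simp: out_degree_add_vertex le_SucI)
qed

text \<open>Vertices of \<open>S\<close> had degree at least \<open>k\<close> before and gain the
  neighbour \<open>v\<close>, so they now exceed \<open>k\<close>; other old vertices keep their
  degree.\<close>

lemma verts_of_degree_add_vertex:
  assumes "k_tree k G" "clique G S" "card S = k" "v \<notin> pverts G"
  shows "verts_of_degree k (add_vertex G v S) = insert v (verts_of_degree k G - S)"
proof -
  have S: "S \<subseteq> pverts G" using assms(2) by (simp add: clique_def)
  have "Suc (out_degree (with_proj G) u) \<noteq> k" if "u \<in> S" for u
    using k_tree_out_degree_ge[OF assms(1)] S that by fastforce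
  moreover have "pverts (add_vertex G v S) = insert v (pverts G)"
    by (simp add: add_vertex_def)
  ultimately show ?thesis
    using assms S out_degree_add_vertex[OF k_tree_pair_graph[OF assms(1)] S assms(4)]
    by (auto simp: verts_of_degree_def split: if_splits)
qed

text \<open>The complete graph is an exception: all its \<open>k + 1\<close> vertices have degree
  \<open>k\<close> and, for \<open>k \<ge> 1\<close>, they are pairwise adjacent.\<close>

lemma k_tree_verts_of_degree:
  assumes "k_tree k G" "\<not> K\<^bsub>k + 1\<^esub> (with_proj G)"
  shows "indep G (verts_of_degree k G) \<and> 2 \<le> card (verts_of_degree k G)"
  using assms
proof (induction rule: k_tree.induct)
  case (base G)
  then show ?case by simp
next
  case (step G S v)
  interpret pair_graph G using step.hyps(1) by (rule k_tree_pair_graph)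
  let ?D = "verts_of_degree k G"
  let ?D' = "verts_of_degree k (add_vertex G v S)"
  have S: "S \<subseteq> pverts G" using step.hyps by (simp add: clique_def)
  then have finS: "finite S" using pair_finite_verts by (rule finite_subset)
  have D: "?D \<subseteq> pverts G" by (auto simp: verts_of_degree_def)
  then have finD: "finite ?D" using pair_finite_verts by (rule finite_subset)
  have new: "(v, w) \<notin> parcs G" "(w, v) \<notin> parcs G" for w
    using step.hyps by (auto dest: in_arcsD1 in_arcsD2)
  \<comment> \<open>One surviving vertex suffices, since \<open>v\<close> will be the second. The
    induction hypothesis says nothing about a complete \<open>G\<close>, hence the case
    split.\<close>
  have rest: "indep G (?D - S) \<and> 1 \<le> card (?D - S)"
  proof (cases "K\<^bsub>k + 1\<^esub> (with_proj G)")
    case True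
    then have "?D = pverts G" "card (pverts G) = k + 1"
      by (auto simp: verts_of_degree_def out_degree_complete complete_digraph_def)
    then have card1: "card (?D - S) = 1"
      using S finS step.hyps by (simp add: card_Diff_subset)
    then obtain w where "?D - S = {w}" by (auto simp: card_1_singleton_iff)
    with card1 show ?thesis
      using pair_no_loops by (fastforce simp: indep_def)
  next
    case False
    then have IH: "indep G ?D" "2 \<le> card ?D" using step.IH by auto
    have "card (S \<inter> ?D) \<le> 1"
      using step.hyps(2) IH(1) by (rule card_clique_Int_indep)
    \<comment> \<open>Of at least two vertices in \<open>?D\<close>, at most one is lost to
      \<open>S\<close>.\<close>
    then have "1 \<le> card (?D - S)"
      using IH(2) finS by (simp add: card_Diff_subset_Int Int_commute)
    with IH(1) show ?thesis by (auto simp: indep_def)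
  qed
  have D': "?D' = insert v (?D - S)"
    using step.hyps by (intro verts_of_degree_add_vertex)
  have "v \<notin> ?D" "v \<notin> S" using D S step.hyps by auto
  then have "2 \<le> card ?D'"
    using rest finD by (simp add: D')
  \<comment> \<open>The new arcs all join \<open>v\<close> to \<open>S\<close>, and \<open>S\<close>
    is disjoint from \<open>?D'\<close>.\<close>
  moreover have "indep (add_vertex G v S) ?D'"
    unfolding D' using rest new \<open>v \<notin> S\<close> by (auto simp: indep_def add_vertex_def)
  ultimately show ?case by blast
qed

theorem theorem4p28:
  fixes G :: "'a pair_pre_digraph" and k :: nat
  assumes "k \<ge> 1" and "k_tree k G" and "cobipartite G"
  shows "linear_k_tree k G"
proof (cases "K\<^bsub>k + 1\<^esub> (with_proj G)")
  case True
  with assms show ?thesis by (simp add: linear_k_tree_def)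
next
  case False
  let ?D = "verts_of_degree k G"
  obtain A B where AB: "A \<union> B = pverts G" "clique G A" "clique G B"
    using assms(3) by (auto simp: cobipartite_def)
  have D: "indep G ?D" "2 \<le> card ?D"
    using k_tree_verts_of_degree[OF assms(2) False] by auto
  have "?D = (A \<inter> ?D) \<union> (B \<inter> ?D)"
    using AB(1) by (auto simp: verts_of_degree_def)
  then have "card ?D \<le> card (A \<inter> ?D) + card (B \<inter> ?D)"
    by (metis card_Un_le)
  \<comment> \<open>Each of the two cliques contributes at most one vertex of the independent set
    \<open>?D\<close>.\<close>
  also have "\<dots> \<le> 1 + 1"
    using AB D by (intro add_mono card_clique_Int_indep)
  finally have "card ?D = 2" using D by simp
  with assms(2) show ?thesis
    by (simp add: linear_k_tree_def verts_of_degree_def)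
qed

end
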